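(* Let $a\in(0,1)$, $b>0$, $V>0$, $\kappa_1>0$, $\kappa_2<0$ be real numbers and let $T^*>0$ be a given maximum temperature. Put $$\beta=\frac{a-1}{b}\frac{1}{V\kappa_1\kappa_2}>0,\qquad \tilde T^*=-\frac{\kappa_2}{T^*},\qquad \alpha^*=\frac{1}{\tilde T^*}\left(1-\frac{e^{-\tilde T^*}}{\beta\tilde T^*}\right),\qquad P_C^*=\frac{a-1}{b}\,\alpha^*\kappa_2 .$$ Then for every $P_C$ with $0<P_C<P_C^*$, the temperature iteration $$T[k+1]=aT[k]+b\left(P_C+V\kappa_1T[k]^2e^{\kappa_2/T[k]}\right)$$ on $(0,\infty)$ has a stable fixed point, and this stable fixed point is less than $T^*$.
   Context: A fixed point of the iteration is a $T>0$ with $T=aT+b\left(P_C+V\kappa_1T^2e^{\kappa_2/T}\right)$. A fixed point is called stable if it attracts nearby trajectories, i.e. every iteration started sufficiently close to it converges to it. Here $P_C$ is the temperature-independent part of the power consumption, and temperatures are absolute (positive). *)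

theory Defs
  imports Complex_Main
begin

definition temp_step :: "real \<Rightarrow> real \<Rightarrow> real \<Rightarrow> real \<Rightarrow> real \<Rightarrow> real \<Rightarrow> real \<Rightarrow> real" where
  "temp_step a b V \<kappa>1 \<kappa>2 P\<^sub>C T = a * T + b * (P\<^sub>C + V * \<kappa>1 * T\<^sup>2 * exp (\<kappa>2 / T))"

text \<open>
  Stability is attraction of all nearby trajectories; no condition on the derivative of the
  map is imposed. Starting points are restricted to the state space \<open>S\<close>.
\<close>

definition stable_fixed_point_on :: "real set \<Rightarrow> (real \<Rightarrow> real) \<Rightarrow> real \<Rightarrow> bool" where
  "stable_fixed_point_on S f p \<longleftrightarrow>
     p \<in> S \<and> f p = p \<and>
     (\<exists>\<delta>>0. \<forall>x\<in>S. \<bar>x - p\<bar> < \<delta> \<longrightarrow> (\<lambda>k. (f ^^ k) x) \<longlonglongrightarrow> p)"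

end

(* The increment of the iteration, g T = temp_step T - T, is convex on the positive reals, and
   P_C < P_C^* says exactly that g is negative at the maximum temperature M, while g is positive
   near 0.  So g has a zero p < M; by convexity g is positive on (0, p) and negative on (p, M], and
   since the iteration map is increasing, all trajectories started in (0, M] converge monotonically
   to p.  At a zero q > M, convexity makes g negative on (M, q), so that trajectories started there
   move away from q. *)
theory Submission
  imports Defs "HOL-Analysis.Convex"
begin

section \<open>Iterating an increasing map of the line\<close>

text \<open>The orbit increases and stays below \<open>p\<close>, so it has a limit in
  \<open>{x..p}\<close>. By continuity this limit is a fixed point, and \<open>above\<close> rules
  out all of them but \<open>p\<close>.\<close>

lemma funpow_tendsto_fixpoint_from_below:
  fixes f :: "real \<Rightarrow> real"
  assumes "x \<le> p" and mono: "mono_on {x..p} f" and cont: "continuous_on {x..p} f"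
    and fp: "f p = p" and above: "\<And>y. x \<le> y \<Longrightarrow> y < p \<Longrightarrow> y < f y"
  shows "(\<lambda>k. (f ^^ k) x) \<longlonglongrightarrow> p"
proof -
  have step: "y \<le> f y \<and> f y \<le> p" if "y \<in> {x..p}" for y
  proof -
    have "f y \<le> f p"
      using that \<open>x \<le> p\<close> by (intro mono_onD[OF mono]) auto
    moreover have "y \<le> f y"
      using above[of y] fp that by (cases "y = p") auto
    ultimately show ?thesis
      using fp by simp
  qed
  have range: "(f ^^ k) x \<in> {x..p}" for k
  proof (induction k)
    case 0
    then show ?case using \<open>x \<le> p\<close> by simp
  next
    case (Suc k)
    then show ?case using step[of "(f ^^ k) x"] by auto
  qed
  have "incseq (\<lambda>k. (f ^^ k) x)"
    using step[OF range] by (intro incseq_SucI) simp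
  moreover have "\<forall>k. (f ^^ k) x \<le> p"
    using range by auto
  ultimately obtain L where lim: "(\<lambda>k. (f ^^ k) x) \<longlonglongrightarrow> L"
    by (blast elim: incseq_convergent)
  have L: "L \<in> {x..p}"
    using range by (intro Lim_in_closed_set[OF closed_atLeastAtMost _ _ lim]) auto
  have "(\<lambda>k. f ((f ^^ k) x)) \<longlonglongrightarrow> f L"
    by (rule continuous_on_tendsto_compose[OF cont lim L]) (use range in auto)
  moreover have "(\<lambda>k. f ((f ^^ k) x)) \<longlonglongrightarrow> L"
    using LIMSEQ_Suc[OF lim] by simp
  ultimately have "f L = L"
    by (rule LIMSEQ_unique)
  then have "L = p"
    using above[of L] L by fastforce
  then show ?thesis
    using lim by simp
qed

text \<open>Conjugation with negation reverses the order and reduces this to the approach from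
  below.\<close>

lemma funpow_tendsto_fixpoint_from_above:
  fixes f :: "real \<Rightarrow> real"
  assumes "p \<le> x" and mono: "mono_on {p..x} f" and cont: "continuous_on {p..x} f"
    and fp: "f p = p" and below: "\<And>y. p < y \<Longrightarrow> y \<le> x \<Longrightarrow> f y < y"
  shows "(\<lambda>k. (f ^^ k) x) \<longlonglongrightarrow> p"
proof -
  define h where "h y = - f (- y)" for y
  have "(\<lambda>k. (h ^^ k) (- x)) \<longlonglongrightarrow> - p"
  proof (rule funpow_tendsto_fixpoint_from_below)
    show "mono_on {- x..- p} h"
      unfolding h_def by (intro mono_onI le_imp_neg_le mono_onD[OF mono]) auto
    show "continuous_on {- x..- p} h"
      unfolding h_def by (intro continuous_intros continuous_on_compose2[OF cont]) auto
    show "y < h y" if "- x \<le> y" "y < - p" for y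
      using below[of "- y"] that by (simp add: h_def)
  qed (use assms in \<open>auto simp: h_def\<close>)
  moreover have "(h ^^ k) (- x) = - (f ^^ k) x" for k
    by (induction k) (auto simp: h_def)
  ultimately show ?thesis
    using tendsto_minus_cancel by auto
qed

section \<open>The temperature iteration\<close>

lemma mono_on_temp_step:
  assumes "0 < a" "0 < b" "0 < V" "0 < \<kappa>1" "\<kappa>2 < 0"
  shows "mono_on {0<..} (temp_step a b V \<kappa>1 \<kappa>2 P)"
proof (rule mono_onI)
  fix x y :: real
  assume "x \<in> {0<..}" "y \<in> {0<..}" "x \<le> y"
  then have "x\<^sup>2 * exp (\<kappa>2 / x) \<le> y\<^sup>2 * exp (\<kappa>2 / y)"
    using assms by (intro mult_mono power_mono) (auto simp: divide_simps)
  then have "V * \<kappa>1 * (x\<^sup>2 * exp (\<kappa>2 / x)) \<le> V * \<kappa>1 * (y\<^sup>2 * exp (\<kappa>2 / y))"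
    using assms by (intro mult_left_mono) auto
  then show "temp_step a b V \<kappa>1 \<kappa>2 P x \<le> temp_step a b V \<kappa>1 \<kappa>2 P y"
    unfolding temp_step_def using assms \<open>x \<le> y\<close>
    by (intro add_mono mult_left_mono) (auto simp: mult.assoc)
qed

lemma continuous_on_temp_step: "continuous_on {0<..} (temp_step a b V \<kappa>1 \<kappa>2 P)"
  unfolding temp_step_def by (intro continuous_intros) auto

text \<open>For \<open>c \<le> 0\<close> and positive \<open>x\<close> the factor
  \<open>(2 * x - c) * c\<close> is nonpositive, which gives the sign of the second
  derivative.\<close>

lemma convex_on_square_mult_exp_inverse:
  fixes c :: real
  assumes "c \<le> 0"
  shows "convex_on {0<..} (\<lambda>x. x\<^sup>2 * exp (c / x))"
proof (rule f''_ge0_imp_convex)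
  show "((\<lambda>x. x\<^sup>2 * exp (c / x)) has_real_derivative (2 * x - c) * exp (c / x)) (at x)"
    if "x \<in> {0<..}" for x
    using that by (auto intro!: derivative_eq_intros simp: field_simps power2_eq_square)
  show "((\<lambda>x. (2 * x - c) * exp (c / x)) has_real_derivative
          (2 - (2 * x - c) * c / x\<^sup>2) * exp (c / x)) (at x)"
    if "x \<in> {0<..}" for x
    using that by (auto intro!: derivative_eq_intros simp: field_simps power2_eq_square)
  show "0 \<le> (2 - (2 * x - c) * c / x\<^sup>2) * exp (c / x)" if "x \<in> {0<..}" for x
  proof -
    have "(2 * x - c) * c / x\<^sup>2 \<le> 0"
      using that assms by (intro divide_nonpos_nonneg mult_nonneg_nonpos) auto
    then show ?thesis
      by simp
  qed
qed simp

lemma convex_on_temp_step_diff: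
  assumes "0 < b" "0 < V" "0 < \<kappa>1" "\<kappa>2 < 0"
  shows "convex_on {0<..} (\<lambda>T. temp_step a b V \<kappa>1 \<kappa>2 P T - T)"
proof -
  have "convex_on {0<..} (\<lambda>T. (b * V * \<kappa>1) * (T\<^sup>2 * exp (\<kappa>2 / T)))"
    using assms by (intro convex_on_cmul convex_on_square_mult_exp_inverse) auto
  moreover have "convex_on {0<..} (\<lambda>T::real. (a - 1) * T + b * P)"
    by (intro convex_onI) (auto simp: algebra_simps)
  ultimately have "convex_on {0<..}
      (\<lambda>T. (b * V * \<kappa>1) * (T\<^sup>2 * exp (\<kappa>2 / T)) + ((a - 1) * T + b * P))"
    by (rule convex_on_add)
  then show ?thesis
    by (simp add: temp_step_def algebra_simps)
qed

text \<open>The point \<open>x\<close> is a convex combination of \<open>p\<close> and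
  \<open>m\<close> with positive weight on \<open>m\<close>. Both orders of \<open>p\<close> and
  \<open>m\<close> occur below: the first to show attraction to \<open>p\<close>, the second
  repulsion from a zero beyond the maximum temperature.\<close>

lemma convex_on_neg_between:
  fixes g :: "real \<Rightarrow> real"
  assumes conv: "convex_on S g" and "p \<in> S" "m \<in> S" "g p = 0" "g m < 0"
    and between: "p < x \<and> x \<le> m \<or> m \<le> x \<and> x < p"
  shows "g x < 0"
proof -
  define t where "t = (x - p) / (m - p)"
  have "m \<noteq> p"
    using assms by auto
  then have x: "x = (1 - t) * p + t * m"
    by (simp add: t_def divide_simps) (simp add: algebra_simps)
  have t: "0 < t" "t \<le> 1"
    using between by (auto simp: t_def divide_simps)
  have "g x \<le> (1 - t) * g p + t * g m"
    using convex_onD[OF conv, of t p m] t assms by (simp add: x)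
  also have "\<dots> < 0"
    using t assms by (simp add: mult_pos_neg)
  finally show ?thesis .
qed

lemma temp_step_less_iff:
  assumes "0 < b"
  shows "temp_step a b V \<kappa>1 \<kappa>2 P T < T \<longleftrightarrow>
    P < (1 - a) * T / b - V * \<kappa>1 * T\<^sup>2 * exp (\<kappa>2 / T)"
  using assms by (simp add: temp_step_def field_simps)

lemma stable_fixed_point_temp_step:
  assumes "0 < a" "0 < b" "0 < V" "0 < \<kappa>1" "\<kappa>2 < 0" "0 < P"
    and M: "0 < M" "temp_step a b V \<kappa>1 \<kappa>2 P M < M"
  shows "\<exists>T. stable_fixed_point_on {0<..} (temp_step a b V \<kappa>1 \<kappa>2 P) T"
proof -
  define f where "f = temp_step a b V \<kappa>1 \<kappa>2 P"
  define g where "g = (\<lambda>T. f T - T)"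
  have mono: "mono_on {0<..} f"
    unfolding f_def using assms by (intro mono_on_temp_step) auto
  have cont: "continuous_on {0<..} f"
    unfolding f_def by (rule continuous_on_temp_step)
  have conv: "convex_on {0<..} g"
    unfolding g_def f_def using assms by (intro convex_on_temp_step_diff) auto
  have gM: "g M < 0"
    using M by (simp add: g_def f_def)
  \<comment> \<open>The bound \<open>e \<le> b * P\<close> lets the constant heating term compensate
    the \<open>- e\<close> in \<open>g e\<close>; the bound \<open>e \<le> M\<close> gives an
    interval for the intermediate value theorem.\<close>
  define e where "e = min M (b * P)"
  have e: "0 < e" "e \<le> M"
    using assms by (auto simp: e_def)
  have "0 < a * e" "0 < b * (V * \<kappa>1 * e\<^sup>2 * exp (\<kappa>2 / e))"
    using assms e by simp_all
  moreover have "e \<le> b * P"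
    by (simp add: e_def)
  ultimately have ge: "0 < g e"
    unfolding g_def f_def temp_step_def distrib_left by linarith
  obtain p where p: "e \<le> p" "p \<le> M" "g p = 0"
    using IVT2'[of g M 0 e] ge gM e
      continuous_on_subset[OF cont, of "{e..M}"]
    unfolding g_def by (force intro!: continuous_intros)
  then have p0: "0 < p" and pM: "p < M" and fp: "f p = p"
    using e gM by (auto simp: g_def less_le)
  \<comment> \<open>If \<open>g y \<le> 0\<close>, then \<open>p\<close>, lying strictly between
    \<open>y\<close> and \<open>M\<close>, would inherit \<open>g p < 0\<close> from
    \<open>g M < 0\<close> by convexity.\<close>
  have pos: "y < f y" if "0 < y" "y < p" for y
  proof (rule ccontr)
    assume "\<not> y < f y"
    then have gy: "g y \<le> 0"
      by (simp add: g_def)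
    define t where "t = (p - y) / (M - y)"
    have t: "0 < t" "t \<le> 1"
      using that pM by (auto simp: t_def divide_simps)
    have "p = (1 - t) * y + t * M"
      using that pM by (simp add: t_def divide_simps) (simp add: algebra_simps)
    then have "g p \<le> (1 - t) * g y + t * g M"
      using convex_onD[OF conv, of t y M] t that M by simp
    moreover have "(1 - t) * g y \<le> 0" "t * g M < 0"
      using t gy gM by (auto intro: mult_nonneg_nonpos mult_pos_neg)
    ultimately show False
      using p by simp
  qed
  have neg: "f y < y" if "p < y" "y \<le> M" for y
    using convex_on_neg_between[OF conv, of p M y] p p0 M gM that
    by (simp add: g_def)
  have "(\<lambda>k. (f ^^ k) x) \<longlonglongrightarrow> p" if "0 < x" "x \<le> M" for x
  proof (cases "x \<le> p")
    case True
    show ?thesis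
      using True that pos fp
      by (intro funpow_tendsto_fixpoint_from_below
          mono_on_subset[OF mono] continuous_on_subset[OF cont]) auto
  next
    case False
    show ?thesis
      using False that p0 neg fp
      by (intro funpow_tendsto_fixpoint_from_above
          mono_on_subset[OF mono] continuous_on_subset[OF cont]) auto
  qed
  then have "stable_fixed_point_on {0<..} f p"
    unfolding stable_fixed_point_on_def
    \<comment> \<open>All of \<open>{0<..M}\<close> is attracted to \<open>p\<close>, so the radius
      only has to keep starting points below \<open>M\<close>.\<close>
    using p0 fp pM by (intro conjI exI[of _ "M - p"]) auto
  then show ?thesis
    unfolding f_def by blast
qed

text \<open>The bound covers every stable fixed point, not just the one constructed above. A fixed
  point beyond \<open>M\<close> fails to attract from its left.\<close>

lemma stable_fixed_point_temp_step_less: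
  assumes "0 < a" "0 < b" "0 < V" "0 < \<kappa>1" "\<kappa>2 < 0" "0 < P"
    and M: "0 < M" "temp_step a b V \<kappa>1 \<kappa>2 P M < M"
    and stable: "stable_fixed_point_on {0<..} (temp_step a b V \<kappa>1 \<kappa>2 P) q"
  shows "q < M"
proof (rule ccontr)
  define f where "f = temp_step a b V \<kappa>1 \<kappa>2 P"
  have mono: "mono_on {0<..} f"
    unfolding f_def using assms by (intro mono_on_temp_step) auto
  have conv: "convex_on {0<..} (\<lambda>T. f T - T)"
    unfolding f_def using assms by (intro convex_on_temp_step_diff) auto
  have fM: "f M < M"
    using M by (simp add: f_def)
  obtain \<delta> where fq: "f q = q" and "0 < \<delta>"
    and attr: "\<And>x. 0 < x \<Longrightarrow> \<bar>x - q\<bar> < \<delta> \<Longrightarrow> (\<lambda>k. (f ^^ k) x) \<longlonglongrightarrow> q"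
    using stable unfolding stable_fixed_point_on_def f_def by auto
  assume "\<not> q < M"
  then have "M < q"
    using fM fq by (cases "q = M") auto
  \<comment> \<open>A starting point close enough to \<open>q\<close> to be attracted, yet in
    \<open>{M..<q}\<close>, where the increment is negative.\<close>
  define x where "x = max M (q - \<delta> / 2)"
  have x: "M \<le> x" "x < q" "\<bar>x - q\<bar> < \<delta>"
    using \<open>M < q\<close> \<open>0 < \<delta>\<close> by (auto simp: x_def)
  have fx: "f x < x"
    using convex_on_neg_between[OF conv, of q M x] M fM fq x \<open>M < q\<close> by simp
  have "\<forall>\<^sub>F k in sequentially. x < (f ^^ k) x"
    using x M by (intro order_tendstoD(1)[OF attr]) auto
  then obtain N where *: "x < (f ^^ N) x"
    by (auto dest: eventually_happens)
  have pos: "0 < f y" if "0 < y" for y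
    unfolding f_def temp_step_def using that assms by (intro add_pos_pos mult_pos_pos) auto
  \<comment> \<open>Since \<open>f x < x\<close> and \<open>f\<close> is increasing, the orbit never
    rises above \<open>x\<close>, whereas convergence to \<open>q > x\<close> would force it
    to.\<close>
  have "(f ^^ k) x \<in> {0<..x}" for k
  proof (induction k)
    case 0
    then show ?case using M x by simp
  next
    case (Suc k)
    then have "f ((f ^^ k) x) \<le> f x"
      by (intro mono_onD[OF mono]) auto
    with Suc pos fx show ?case by simp
  qed
  with * show False
    by (meson greaterThanAtMost_iff not_less)
qed

theorem mainTheorem3:
  fixes a b V \<kappa>1 \<kappa>2 Tmax \<beta> Ttilde \<alpha>max Pmax :: real
  assumes "0 < a" and "a < 1" and "0 < b" and "0 < V" and "0 < \<kappa>1" and "\<kappa>2 < 0"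
    and "0 < Tmax"
    and "\<beta> = (a - 1) / b * (1 / (V * \<kappa>1 * \<kappa>2))"
    and "Ttilde = - \<kappa>2 / Tmax"
    and "\<alpha>max = 1 / Ttilde * (1 - exp (- Ttilde) / (\<beta> * Ttilde))"
    and "Pmax = (a - 1) / b * \<alpha>max * \<kappa>2"
  shows "0 < \<beta> \<and>
    (\<forall>P\<^sub>C. 0 < P\<^sub>C \<and> P\<^sub>C < Pmax \<longrightarrow>
       (\<exists>T. stable_fixed_point_on {0<..} (temp_step a b V \<kappa>1 \<kappa>2 P\<^sub>C) T) \<and>
       (\<forall>T. stable_fixed_point_on {0<..} (temp_step a b V \<kappa>1 \<kappa>2 P\<^sub>C) T \<longrightarrow> T < Tmax))"
proof -
  have "0 < \<beta>"
    unfolding assms(8) using assms(1-6)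
    by (simp add: zero_less_divide_iff zero_less_mult_iff mult_less_0_iff)
  \<comment> \<open>Unfolded, \<open>Pmax\<close> is the power for which \<open>Tmax\<close> itself
    is a fixed point; any smaller power makes the increment at \<open>Tmax\<close> negative.\<close>
  moreover have Pmax: "Pmax = (1 - a) * Tmax / b - V * \<kappa>1 * Tmax\<^sup>2 * exp (\<kappa>2 / Tmax)"
    unfolding assms(8-11) using assms(1-7)
    by (simp add: field_simps power2_eq_square)
  then have below: "temp_step a b V \<kappa>1 \<kappa>2 P Tmax < Tmax" if "P < Pmax" for P
    using that \<open>0 < b\<close> by (simp add: temp_step_less_iff)
  ultimately show ?thesis
    using assms(1-7) stable_fixed_point_temp_step[OF _ _ _ _ _ _ _ below]
      stable_fixed_point_temp_step_less[OF _ _ _ _ _ _ _ below]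
    by blast
qed

end
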